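(* Let $n \ge 1$ be an integer, let $x_1 < x_2 < \cdots < x_{n+1}$ be real numbers, write $\mathbf{x} = (x_1,\ldots,x_{n+1})$, and let $$R(\mathbf{x}) := [x_1,x_2]\times[x_2,x_3]\times\cdots\times[x_n,x_{n+1}] \subset \mathbb{R}^n .$$ For $i=1,\ldots,n+1$ let $$y_i := \Big(\sum_{j=1}^{n+1} x_j\Big) - x_{n+2-i},$$ so that $y_1 < y_2 < \cdots < y_{n+1}$, and $y_1 \le t_1+\cdots+t_n \le y_{n+1}$ for all $(t_1,\ldots,t_n)\in R(\mathbf{x})$. Then for every $f \in C^n[y_1,y_{n+1}]$, $$\int_{R(\mathbf{x})} V(\mathbf{t})\, f^{(n)}(t_1+t_2+\cdots+t_n)\, d\mathbf{t} = V(\mathbf{x})\,[y_1,y_2,\ldots,y_{n+1}]f .$$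
   Context: For any integer $m \ge 1$ and $\mathbf{t}=(t_1,\ldots,t_m)\in\mathbb{R}^m$, the Vandermonde polynomial is $V(\mathbf{t}) = V(t_1,\ldots,t_m) := \prod_{1\le i<j\le m}(t_j-t_i)$ (the empty product is $1$, so $V=1$ when $m=1$). In the claim, $V(\mathbf{t})$ has $n$ variables $\mathbf{t}=(t_1,\ldots,t_n)$ and $V(\mathbf{x})$ has $n+1$ variables. The integral is $\int_{R(\mathbf{x})}\phi(\mathbf{t})\,d\mathbf{t} := \int_{x_n}^{x_{n+1}}\cdots\int_{x_2}^{x_3}\int_{x_1}^{x_2}\phi(t_1,\ldots,t_n)\,dt_1\,dt_2\cdots dt_n$. $C^n[a,b]$ denotes the real-valued functions that are $n$ times continuously differentiable on $[a,b]$ (one-sided derivatives at the endpoints). For distinct points $y_1,\ldots,y_{n+1}$, the divided difference of $f$ is $[y_1,\ldots,y_{n+1}]f := \sum_{i=1}^{n+1}\dfrac{f(y_i)}{\prod_{j=1,\,j\ne i}^{n+1}(y_i-y_j)}$. *)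

theory Defs
  imports "HOL-Analysis.Analysis"
begin

text \<open>A tuple \<open>(t\<^sub>1, \<dots>, t\<^sub>m)\<close> is a function \<open>nat \<Rightarrow> real\<close> of which only the values on \<open>{1..m}\<close> matter.\<close>

definition vandermonde :: "nat \<Rightarrow> (nat \<Rightarrow> real) \<Rightarrow> real" where
  "vandermonde m t = (\<Prod>(i, j) \<in> {(i, j). 1 \<le> i \<and> i < j \<and> j \<le> m}. t j - t i)"

definition interlacing_box :: "nat \<Rightarrow> (nat \<Rightarrow> real) \<Rightarrow> (nat \<Rightarrow> real) set" where
  "interlacing_box n x = (\<Pi>\<^sub>E i \<in> {1..n}. {x i..x (i + 1)})"

text \<open>
  The iterated integral over \<open>interlacing_box n x\<close>; the variable with the largest index is outermost.
  The base point \<open>\<lambda>_. undefined\<close> makes every tuple at which \<open>\<phi>\<close> is evaluated an element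
  of \<open>interlacing_box n x\<close>.
\<close>

primrec box_integral :: "nat \<Rightarrow> (nat \<Rightarrow> real) \<Rightarrow> ((nat \<Rightarrow> real) \<Rightarrow> real) \<Rightarrow> real" where
  "box_integral 0 x \<phi> = \<phi> (\<lambda>_. undefined)"
| "box_integral (Suc n) x \<phi> =
     integral {x (Suc n)..x (Suc (Suc n))} (\<lambda>s. box_integral n x (\<lambda>t. \<phi> (t(Suc n := s))))"

text \<open>
  Derivatives are taken within \<open>S\<close>, so on a nondegenerate closed interval they are one-sided
  at the endpoints, and values outside the interval play no role.
\<close>

primrec nth_deriv_within :: "nat \<Rightarrow> real set \<Rightarrow> (real \<Rightarrow> real) \<Rightarrow> real \<Rightarrow> real" where
  "nth_deriv_within 0 S f = f"
| "nth_deriv_within (Suc k) S f =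
     (\<lambda>u. vector_derivative (nth_deriv_within k S f) (at u within S))"

definition Cn_on :: "nat \<Rightarrow> real set \<Rightarrow> (real \<Rightarrow> real) \<Rightarrow> bool" where
  "Cn_on n S f \<longleftrightarrow>
     (\<forall>k<n. nth_deriv_within k S f differentiable_on S) \<and> continuous_on S (nth_deriv_within n S f)"

text \<open>The divided difference \<open>[y\<^sub>1, \<dots>, y\<^sub>m]f\<close>, for distinct points \<open>y\<^sub>1, \<dots>, y\<^sub>m\<close>.\<close>

definition divided_difference :: "nat \<Rightarrow> (nat \<Rightarrow> real) \<Rightarrow> (real \<Rightarrow> real) \<Rightarrow> real" where
  "divided_difference m y f = (\<Sum>i = 1..m. f (y i) / (\<Prod>j \<in> {1..m} - {i}. y i - y j))"

end

theory Submission
  imports Defs "Jordan_Normal_Form.Determinant"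
begin

text \<open>
  With \<open>\<sigma> t = t\<^sub>1 + \<dots> + t\<^sub>n\<close> and \<open>H t = V t * f (\<sigma> t)\<close>, both sides of the identity are the same alternating
  sum over corners of the box.

  The integrand is the mixed derivative \<open>\<partial>\<^sub>1 \<dots> \<partial>\<^sub>n H\<close>. By the product rule this derivative is the sum, over
  the sets \<open>A\<close> of variables that hit the first factor, of \<open>(\<partial>\<^sub>A V) t\<close> times the derivative of \<open>f\<close> of order
  \<open>n - |A|\<close> at \<open>\<sigma> t\<close>. For each \<open>a \<ge> 1\<close> the terms with \<open>|A| = a\<close> cancel, because \<open>e\<^sub>a(\<partial>) V = 0\<close>
  for the elementary symmetric polynomial \<open>e\<^sub>a\<close>. This follows from writing \<open>V\<close> as a determinant
  with rows \<open>1, t\<^sub>i, t\<^sub>i\<^sup>2, \<dots>\<close>: the operator \<open>\<partial>\<^sub>A\<close> differentiates the rows in \<open>A\<close>, and expanding all determinants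
  over permutations shows that summing over sets of rows is the same as summing over sets \<open>J\<close> of columns.
  If \<open>J\<close> is nonempty with least element \<open>m\<close>, the differentiated column \<open>m\<close> is \<open>m\<close> times
  the untouched column \<open>m - 1\<close>, or zero if \<open>m = 0\<close>, and the determinant vanishes
  (\<open>sum_partial_vandermonde\<close>).

  The fundamental theorem of calculus, applied in one variable after the other, turns the integral
  into the alternating sum of \<open>H\<close> over the corners of the box
  (\<open>box_fundamental_theorem_of_calculus\<close>). Neighbouring edges of the box share an endpoint, so a
  corner that takes the upper end of \<open>[x\<^sub>i, x\<^sub>i\<^sub>+\<^sub>1]\<close> and the lower end of the next edge has two equal
  coordinates, and \<open>V\<close> vanishes there. The remaining corners are \<open>x\<close> with one entry \<open>x\<^sub>k\<close> omitted
  (\<open>alternating_corner_sum\<close>). There \<open>\<sigma>\<close> takes the value \<open>\<Sum>\<^sub>j x\<^sub>j - x\<^sub>k\<close>, which is one of the nodes \<open>y\<^sub>i\<close>, and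
  \<open>V\<close> is, up to the sign of the corner, \<open>V x\<close> divided by the denominator that belongs to this node in the divided difference
  (\<open>vandermonde_div_prod_diff\<close>).
\<close>

section \<open>The Vandermonde product\<close>

lemma finite_index_pairs: "finite {(i, j). 1 \<le> i \<and> i < j \<and> j \<le> (m::nat)}"
  by (rule finite_subset[of _ "{1..m} \<times> {1..m}"]) auto

lemma vandermonde_cong:
  assumes "\<And>i. i \<in> {1..m} \<Longrightarrow> s i = t i"
  shows "vandermonde m s = vandermonde m t"
  unfolding vandermonde_def by (rule prod.cong) (use assms in auto)

lemma vandermonde_eq_0:
  assumes "1 \<le> i" "i < j" "j \<le> m" "t i = t j"
  shows "vandermonde m t = 0"
proof -
  have "\<exists>p\<in>{(i, j). 1 \<le> i \<and> i < j \<and> j \<le> m}. (case p of (i, j) \<Rightarrow> t j - t i) = 0"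
    using assms by (intro bexI[of _ "(i, j)"]) auto
  then show ?thesis
    unfolding vandermonde_def using finite_index_pairs by simp
qed

text \<open>
  The factors of the larger product are sorted by whether the index \<open>k\<close> takes part. Those without \<open>k\<close>
  correspond to the pairs of \<open>n\<close> indices under the increasing map that skips \<open>k\<close>.
\<close>

lemma vandermonde_omit:
  assumes k: "1 \<le> k" "k \<le> Suc n"
  shows "vandermonde (Suc n) x =
    vandermonde n (\<lambda>i. if i < k then x i else x (Suc i)) *
    ((\<Prod>i\<in>{1..<k}. x k - x i) * (\<Prod>j\<in>{k<..Suc n}. x j - x k))"
proof -
  define \<delta> where "\<delta> i = (if i < k then i else Suc i)" for i
  define P where "P m = {(i, j). 1 \<le> i \<and> i < j \<and> j \<le> (m::nat)}" for m
  define f where "f = (\<lambda>(i, j). x j - x i)"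
  let ?P1 = "map_prod \<delta> \<delta> ` P n"
  let ?P2 = "(\<lambda>i. (i, k)) ` {1..<k}"
  let ?P3 = "(\<lambda>j. (k, j)) ` {k<..Suc n}"
  have split: "P (Suc n) = ?P1 \<union> (?P2 \<union> ?P3)"
  proof (intro equalityI subsetI)
    fix p assume "p \<in> P (Suc n)"
    then obtain i j where p: "p = (i, j)" "1 \<le> i" "i < j" "j \<le> Suc n"
      by (auto simp: P_def)
    show "p \<in> ?P1 \<union> (?P2 \<union> ?P3)"
    proof (cases "i = k \<or> j = k")
      case True
      then show ?thesis using p by auto
    next
      case False
      define \<epsilon> where "\<epsilon> a = (if a < k then a else a - 1)" for a
      have "p = map_prod \<delta> \<delta> (\<epsilon> i, \<epsilon> j)"
        using False p by (auto simp: \<delta>_def \<epsilon>_def)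
      moreover have "(\<epsilon> i, \<epsilon> j) \<in> P n"
        using False p k by (auto simp: P_def \<epsilon>_def)
      ultimately show ?thesis by blast
    qed
  next
    fix p assume "p \<in> ?P1 \<union> (?P2 \<union> ?P3)"
    then show "p \<in> P (Suc n)"
      using k by (auto simp: P_def \<delta>_def)
  qed
  have inj\<delta>: "inj \<delta>"
    by (auto simp: inj_def \<delta>_def split: if_splits)
  have \<delta>_neq: "\<delta> i \<noteq> k" "k \<noteq> \<delta> i" for i
    by (simp_all add: \<delta>_def)
  have disj: "?P1 \<inter> (?P2 \<union> ?P3) = {}"
    by (auto simp: \<delta>_neq)
  have disj': "?P2 \<inter> ?P3 = {}"
    by auto
  have fin: "finite (P n)"
    unfolding P_def by (rule finite_index_pairs)
  have "prod f (P (Suc n)) = prod f ?P1 * (prod f ?P2 * prod f ?P3)"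
    unfolding split using disj disj' fin by (simp add: prod.union_disjoint)
  moreover have "prod f ?P1 = prod (f \<circ> map_prod \<delta> \<delta>) (P n)"
    by (rule prod.reindex) (auto intro!: inj_on_subset[OF prod.inj_map] inj\<delta>)
  moreover have "prod (f \<circ> map_prod \<delta> \<delta>) (P n) = vandermonde n (\<lambda>i. x (\<delta> i))"
    unfolding vandermonde_def P_def f_def by (rule prod.cong) auto
  moreover have "(\<lambda>i. x (\<delta> i)) = (\<lambda>i. if i < k then x i else x (Suc i))"
    by (auto simp: \<delta>_def)
  moreover have "prod f ?P2 = (\<Prod>i\<in>{1..<k}. x k - x i)"
    by (subst prod.reindex) (auto simp: inj_on_def f_def)
  moreover have "prod f ?P3 = (\<Prod>j\<in>{k<..Suc n}. x j - x k)"
    by (subst prod.reindex) (auto simp: inj_on_def f_def)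
  ultimately show ?thesis
    by (simp add: vandermonde_def P_def f_def)
qed

text \<open>
  The differences \<open>x j - x k\<close> on the left are the differences between the node that omits \<open>x k\<close> and the other nodes, so this
  product is the denominator of \<open>f\<close> at that node in the divided difference. The sign comes from reversing the \<open>k - 1\<close>
  differences with smaller index.
\<close>

lemma vandermonde_div_prod_diff:
  assumes k: "1 \<le> k" "k \<le> Suc n" and inj: "inj_on x {1..Suc n}"
  shows "vandermonde (Suc n) x / (\<Prod>j\<in>{1..Suc n} - {k}. x j - x k) =
    (-1) ^ (k - 1) * vandermonde n (\<lambda>i. if i < k then x i else x (Suc i))"
proof -
  let ?L = "\<Prod>i\<in>{1..<k}. x i - x k" and ?R = "\<Prod>j\<in>{k<..Suc n}. x j - x k"
  have "{1..Suc n} - {k} = {1..<k} \<union> {k<..Suc n}"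
    using k by auto
  moreover have "(\<Prod>j\<in>{1..<k} \<union> {k<..Suc n}. x j - x k) = ?L * ?R"
    by (rule prod.union_disjoint) auto
  ultimately have "(\<Prod>j\<in>{1..Suc n} - {k}. x j - x k) = ?L * ?R"
    by simp
  moreover have "(\<Prod>i\<in>{1..<k}. x k - x i) = (-1) ^ (k - 1) * ?L"
    using prod.distrib[of "\<lambda>_. -1" "\<lambda>i. x i - x k" "{1..<k}"] by simp
  moreover have "?L \<noteq> 0" "?R \<noteq> 0"
    using k inj_onD[OF inj, of _ k] by force+
  ultimately show ?thesis
    using vandermonde_omit[OF k, of x] by simp
qed

section \<open>The Vandermonde determinant and its partial derivatives\<close>

text \<open>
  Along row \<open>i\<close>, Laplace expansion is linear with coefficients that do not see that row. Both the
  interpolation argument and the differentiation below rest on this.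
\<close>

lemma cofactor_row_cong:
  assumes "A \<in> carrier_mat n n" "B \<in> carrier_mat n n" "i < n" "j < n"
    and "\<And>i' j'. i' < n \<Longrightarrow> j' < n \<Longrightarrow> i' \<noteq> i \<Longrightarrow> A $$ (i', j') = B $$ (i', j')"
  shows "cofactor A i j = cofactor B i j"
proof -
  have "mat_delete A i j = mat_delete B i j"
    using assms by (intro eq_matI) (auto simp: mat_delete_def)
  then show ?thesis by (simp add: cofactor_def)
qed

text \<open>
  This is \<open>\<partial>\<^sub>A V\<close>, the partial derivative of the Vandermonde product once in each variable
  \<open>t i\<close> with \<open>i \<in> A\<close>. Matrix indices start at \<open>0\<close>, variables at \<open>1\<close>; in column \<open>0\<close> the truncated
  exponent \<open>j - 1\<close> is multiplied by \<open>real j = 0\<close>.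
\<close>

definition partial_vandermonde :: "nat \<Rightarrow> nat set \<Rightarrow> (nat \<Rightarrow> real) \<Rightarrow> real" where
  "partial_vandermonde n A t = Determinant.det (Matrix.mat n n
     (\<lambda>(i, j). if Suc i \<in> A then real j * t (Suc i) ^ (j - 1) else t (Suc i) ^ j))"

text \<open>
  The determinant formula for the Vandermonde product. For distinct \<open>t 1, \<dots>, t n\<close>, the determinant of size
  \<open>n + 1\<close> is, as a function of its last variable, a polynomial of degree at most \<open>n\<close> that
  vanishes at these \<open>n\<close> points and whose coefficient of degree \<open>n\<close> is the determinant of size \<open>n\<close>. This determines it.
  If two of the variables coincide, both sides vanish.
\<close>

lemma partial_vandermonde_empty: "partial_vandermonde n {} t = vandermonde n t"
proof (induction n)
  case 0
  have "vandermonde 0 t = 1"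
    unfolding vandermonde_def by (rule prod.neutral) auto
  then show ?case
    by (simp add: partial_vandermonde_def)
next
  case (Suc n)
  define M where "M s = Matrix.mat (Suc n) (Suc n) (\<lambda>(i, j). (t(Suc n := s)) (Suc i) ^ j)" for s
  have M_carrier: "M s \<in> carrier_mat (Suc n) (Suc n)" for s
    by (simp add: M_def)
  have M_index: "M s $$ (i, j) = (t(Suc n := s)) (Suc i) ^ j" if "i < Suc n" "j < Suc n" for s i j
    using that by (simp add: M_def)
  have det_M: "Determinant.det (M (t (Suc n))) = partial_vandermonde (Suc n) {} t"
    by (simp add: M_def partial_vandermonde_def)
  have det_eq_0: "Determinant.det (M s) = 0"
    if "a \<noteq> b" "a \<in> {1..Suc n}" "b \<in> {1..Suc n}" "(t(Suc n := s)) a = (t(Suc n := s)) b" for s a b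
  proof (rule det_identical_rows[OF M_carrier, of "a - 1" "b - 1"])
    show "row (M s) (a - 1) = row (M s) (b - 1)"
    proof (rule eq_vecI)
      fix j assume "j < dim_vec (row (M s) (b - 1))"
      then have j: "j < Suc n" by (simp add: M_def)
      have row: "vec_index (row (M s) (c - 1)) j = (t(Suc n := s)) c ^ j" if "c \<in> {1..Suc n}" for c
        using that j by (subst index_row) (auto simp: M_def)
      show "vec_index (row (M s) (a - 1)) j = vec_index (row (M s) (b - 1)) j"
        by (simp only: row that)
    qed (simp add: M_def)
  qed (use that in auto)
  show ?case
  proof (cases "inj_on t {1..n}")
    case False
    then obtain a b where ab: "a \<in> {1..n}" "b \<in> {1..n}" "a < b" "t a = t b"
      unfolding inj_on_def by (metis linorder_neqE_nat)
    have "Determinant.det (M (t (Suc n))) = 0"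
      by (rule det_eq_0[of a b]) (use ab in auto)
    moreover have "vandermonde (Suc n) t = 0"
      by (rule vandermonde_eq_0[of a b]) (use ab in auto)
    ultimately show ?thesis by (simp add: det_M)
  next
    case True
    define c where "c j = cofactor (M 0) n j" for j
    define p where "p = (\<Sum>j\<le>n. Polynomial.monom (c j) j)"
    define q where "q = Polynomial.smult (vandermonde n t) (\<Prod>i\<in>{1..n}. [:- t i, 1:])"
    have cof: "cofactor (M s) n j = c j" if "j < Suc n" for s j
      unfolding c_def using that
      by (intro cofactor_row_cong[OF M_carrier M_carrier]) (auto simp: M_index)
    have poly_p: "poly p s = Determinant.det (M s)" for s
    proof -
      have "Determinant.det (M s) = (\<Sum>j<Suc n. M s $$ (n, j) * cofactor (M s) n j)"
        by (rule laplace_expansion_row[OF M_carrier]) simp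
      also have "\<dots> = (\<Sum>j<Suc n. s ^ j * c j)"
        by (rule sum.cong) (auto simp: M_index cof)
      also have "\<dots> = poly p s"
        unfolding p_def lessThan_Suc_atMost by (simp add: poly_sum poly_monom mult.commute)
      finally show ?thesis by simp
    qed
    have "c n = partial_vandermonde n {} t"
    proof -
      have "mat_delete (M 0) n n = Matrix.mat n n (\<lambda>(i, j). t (Suc i) ^ j)"
        by (intro eq_matI) (auto simp: mat_delete_def M_def)
      then show ?thesis
        by (simp add: c_def cofactor_def partial_vandermonde_def)
    qed
    moreover have "Polynomial.coeff p n = c n"
      by (simp add: p_def coeff_sum)
    moreover have deg: "Polynomial.degree (\<Prod>i\<in>{1..n}. [:- t i, 1:]) = n"
      by (subst degree_prod_eq_sum_degree) auto
    moreover have "Polynomial.coeff (\<Prod>i\<in>{1..n}. [:- t i, 1:]) n = 1"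
      using lead_coeff_prod[of "\<lambda>i. [:- t i, 1:]" "{1..n}"] deg by simp
    ultimately have "Polynomial.coeff p n = Polynomial.coeff q n"
      by (simp add: q_def Suc.IH)
    moreover have "Polynomial.degree p \<le> n"
      unfolding p_def by (rule degree_sum_le) (auto intro: order.trans[OF degree_monom_le])
    moreover have "Polynomial.degree q \<le> n"
      using deg degree_smult_le[of "vandermonde n t" "\<Prod>i\<in>{1..n}. [:- t i, 1:]"] by (simp add: q_def)
    moreover have "poly p z = poly q z" if z: "z \<in> t ` {1..n}" for z
    proof -
      obtain a where a: "a \<in> {1..n}" "z = t a" using z by blast
      have "Determinant.det (M z) = 0"
        by (rule det_eq_0[of a "Suc n"]) (use a in auto)
      moreover have "poly (\<Prod>i\<in>{1..n}. [:- t i, 1:]) z = 0"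
        using a by (auto simp: poly_prod)
      ultimately show ?thesis by (simp add: poly_p q_def)
    qed
    ultimately have "p = q"
      by (intro poly_eqI_degree_lead_coeff[where A = "t ` {1..n}" and n = n])
        (use True in \<open>auto simp: card_image\<close>)
    have "partial_vandermonde (Suc n) {} t = poly q (t (Suc n))"
      unfolding \<open>p = q\<close>[symmetric] poly_p det_M ..
    also have "\<dots> = vandermonde n t * (\<Prod>i\<in>{1..n}. t (Suc n) - t i)"
      by (simp add: q_def poly_prod)
    also have "\<dots> = vandermonde (Suc n) t"
      using vandermonde_omit[of "Suc n" n t]
        vandermonde_cong[of n "\<lambda>i. if i < Suc n then t i else t (Suc i)" t]
      by (simp add: atLeastLessThanSuc_atLeastAtMost)
    finally show ?thesis .
  qed
qed

text \<open>
  Only row \<open>m\<close> of the matrix contains \<open>t m\<close>, so differentiating the determinant in \<open>t m\<close> differentiates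
  the entries of that row.
\<close>

lemma partial_vandermonde_has_derivative:
  assumes m: "m \<in> {1..n}" "m \<notin> A"
  shows "((\<lambda>s. partial_vandermonde n A (t(m := s))) has_real_derivative
          partial_vandermonde n (insert m A) t) (at (t m) within X)"
proof -
  define M where "M A t = Matrix.mat n n
     (\<lambda>(i, j). if Suc i \<in> A then real j * t (Suc i) ^ (j - 1) else t (Suc i) ^ j)"
    for A and t :: "nat \<Rightarrow> real"
  have M_carrier: "M A t \<in> carrier_mat n n" for A t
    by (simp add: M_def)
  define i where "i = m - 1"
  have i: "i < n" "Suc i = m" using m by (auto simp: i_def)
  define c where "c j = cofactor (M A t) i j" for j
  have cof1: "cofactor (M A (t(m := s))) i j = c j" if "j < n" for s j
    unfolding c_def using that i
    by (intro cofactor_row_cong[OF M_carrier M_carrier]) (auto simp: M_def)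
  have cof2: "cofactor (M (insert m A) t) i j = c j" if "j < n" for j
    unfolding c_def using that i
    by (intro cofactor_row_cong[OF M_carrier M_carrier]) (auto simp: M_def)
  have "partial_vandermonde n A (t(m := s)) = (\<Sum>j<n. s ^ j * c j)" for s
  proof -
    have "partial_vandermonde n A (t(m := s)) =
        (\<Sum>j<n. M A (t(m := s)) $$ (i, j) * cofactor (M A (t(m := s))) i j)"
      unfolding partial_vandermonde_def M_def[symmetric]
      by (rule laplace_expansion_row[OF M_carrier i(1)])
    also have "\<dots> = (\<Sum>j<n. s ^ j * c j)"
      by (rule sum.cong) (use i m cof1 in \<open>auto simp: M_def\<close>)
    finally show ?thesis .
  qed
  moreover have "partial_vandermonde n (insert m A) t = (\<Sum>j<n. real j * t m ^ (j - 1) * c j)"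
  proof -
    have "partial_vandermonde n (insert m A) t =
        (\<Sum>j<n. M (insert m A) t $$ (i, j) * cofactor (M (insert m A) t) i j)"
      unfolding partial_vandermonde_def M_def[symmetric]
      by (rule laplace_expansion_row[OF M_carrier i(1)])
    also have "\<dots> = (\<Sum>j<n. real j * t m ^ (j - 1) * c j)"
      by (rule sum.cong) (use i m cof2 in \<open>auto simp: M_def\<close>)
    finally show ?thesis .
  qed
  ultimately show ?thesis
    by (auto intro!: derivative_eq_intros sum.cong)
qed

text \<open>
  Let \<open>m\<close> be the least differentiated column. Column \<open>m - 1\<close> is not differentiated, so its \<open>m\<close>-fold
  equals column \<open>m\<close>; for \<open>m = 0\<close> column \<open>m\<close> is zero. Either way the columns are linearly dependent.
\<close>

lemma det_differentiated_columns_eq_0: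
  fixes t :: "nat \<Rightarrow> real"
  assumes J: "J \<subseteq> {..<n}" "J \<noteq> {}"
  shows "Determinant.det (Matrix.mat n n
    (\<lambda>(i, j). if j \<in> J then real j * t i ^ (j - 1) else t i ^ j)) = 0"
    (is "Determinant.det ?N = 0")
proof -
  have fin: "finite J" using J finite_subset by blast
  define m where "m = Min J"
  have "m \<in> J" unfolding m_def using J fin by (intro Min_in)
  then have m: "m \<in> J" "m < n" using J by auto
  have pred: "k \<notin> J" if "Suc k = m" for k
    using Min_le[OF fin, of k] that by (auto simp: m_def)
  \<comment> \<open>The linear relation as a vector; if \<open>m = 0\<close>, no index satisfies \<open>Suc k = m\<close>.\<close>
  define v where "v = Matrix.vec n (\<lambda>k. if k = m then 1 else if Suc k = m then - real m else 0)"
  have "?N *\<^sub>v v = 0\<^sub>v n"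
  proof (intro eq_vecI)
    fix i assume "i < dim_vec (0\<^sub>v n :: real Matrix.vec)"
    then have i: "i < n" by simp
    have "vec_index (?N *\<^sub>v v) i =
        (\<Sum>k<n. (if k \<in> J then real k * t i ^ (k - 1) else t i ^ k) *
           (if k = m then 1 else if Suc k = m then - real m else 0))"
      using i by (simp add: scalar_prod_def v_def atLeast0LessThan)
    also have "\<dots> = (\<Sum>k<n. (if k = m then real m * t i ^ (m - 1) else 0) +
        (if Suc k = m then - real m * t i ^ (m - 1) else 0))"
      by (rule sum.cong) (use m pred in auto)
    also have "\<dots> = 0"
    proof (cases m)
      case (Suc l)
      then have "l < n" using m by simp
      then show ?thesis using Suc m by (simp add: sum.distrib algebra_simps)
    qed simp
    finally show "vec_index (?N *\<^sub>v v) i = vec_index (0\<^sub>v n) i" using i by simp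
  qed simp
  moreover have "v \<noteq> 0\<^sub>v n"
  proof
    assume "v = 0\<^sub>v n"
    then have "vec_index v m = vec_index (0\<^sub>v n) m" by simp
    then show False using m by (simp add: v_def)
  qed
  moreover have "v \<in> carrier_vec n" by (simp add: v_def)
  ultimately show ?thesis
    using det_0_iff_vec_prod_zero[of ?N n] by (auto intro!: exI[of _ v])
qed

text \<open>
  As \<open>h\<close> is arbitrary, this says that the sum of \<open>\<partial>\<^sub>A V\<close> over all \<open>A\<close> of a given size \<open>a \<ge> 1\<close> vanishes,
  that is \<open>e\<^sub>a(\<partial>) V = 0\<close>. In the term of a permutation \<open>p\<close>, differentiating a set of columns \<open>J\<close> is the
  same as differentiating the rows \<open>p ` J\<close>. This exchanges the sum over sets of rows, where no single
  term need vanish, for a sum over sets of columns, where only the empty set contributes.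
\<close>

lemma sum_partial_vandermonde:
  "(\<Sum>A\<in>Pow {1..n}. partial_vandermonde n A t * h (card A)) = vandermonde n t * h 0"
proof -
  let ?d = "\<lambda>i j. real j * t (Suc i) ^ (j - 1)" and ?e = "\<lambda>i j. t (Suc i) ^ j"
  define N where "N J = Matrix.mat n n (\<lambda>(i, j). if j \<in> J then ?d i j else ?e i j)" for J
  let ?S = "{p. p permutes {0..<n}}"
  have rows: "(\<Sum>A\<in>Pow {1..n}. (\<Prod>j<n. if Suc (p j) \<in> A then ?d (p j) j else ?e (p j) j) * h (card A)) =
      (\<Sum>J\<in>Pow {..<n}. (\<Prod>j<n. if j \<in> J then ?d (p j) j else ?e (p j) j) * h (card J))"
    if p: "p \<in> ?S" for p
  proof -
    \<comment> \<open>The variable of the row that \<open>p\<close> assigns to column \<open>j\<close>.\<close>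
    define \<pi> where "\<pi> j = Suc (p j)" for j
    have pp: "p permutes {..<n}" using p by (simp add: atLeast0LessThan)
    have inj: "inj_on \<pi> {..<n}"
      using permutes_inj[OF pp] by (auto simp: inj_on_def inj_def \<pi>_def)
    have "\<pi> ` {..<n} = Suc ` p ` {..<n}"
      by (auto simp: \<pi>_def)
    also have "\<dots> = {1..n}"
      unfolding permutes_image[OF pp] by (simp add: image_Suc_lessThan)
    finally have bij: "bij_betw \<pi> {..<n} {1..n}"
      using inj by (simp add: bij_betw_def)
    have "(\<Sum>A\<in>Pow {1..n}. (\<Prod>j<n. if Suc (p j) \<in> A then ?d (p j) j else ?e (p j) j) * h (card A)) =
        (\<Sum>J\<in>Pow {..<n}. (\<Prod>j<n. if Suc (p j) \<in> \<pi> ` J then ?d (p j) j else ?e (p j) j) * h (card (\<pi> ` J)))"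
      using sum.reindex_bij_betw[OF bij_betw_Pow[OF bij]] by (rule sym)
    also have "\<dots> = (\<Sum>J\<in>Pow {..<n}. (\<Prod>j<n. if j \<in> J then ?d (p j) j else ?e (p j) j) * h (card J))"
    proof (rule sum.cong[OF refl])
      fix J assume J: "J \<in> Pow {..<n}"
      then have "Suc (p j) \<in> \<pi> ` J \<longleftrightarrow> j \<in> J" if "j < n" for j
        using that inj_on_image_mem_iff[OF inj, of j J] by (auto simp: \<pi>_def)
      moreover have "card (\<pi> ` J) = card J"
        using J by (intro card_image inj_on_subset[OF inj]) auto
      ultimately show "(\<Prod>j<n. if Suc (p j) \<in> \<pi> ` J then ?d (p j) j else ?e (p j) j) * h (card (\<pi> ` J)) =
          (\<Prod>j<n. if j \<in> J then ?d (p j) j else ?e (p j) j) * h (card J)"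
        by simp
    qed
    finally show ?thesis .
  qed
  have "partial_vandermonde n A t =
      (\<Sum>p\<in>?S. signof p * (\<Prod>j<n. if Suc (p j) \<in> A then ?d (p j) j else ?e (p j) j))" for A
    unfolding partial_vandermonde_def
    by (subst det_col[where n = n]) (auto intro!: sum.cong prod.cong dest: permutes_in_image)
  then have "(\<Sum>A\<in>Pow {1..n}. partial_vandermonde n A t * h (card A)) =
      (\<Sum>p\<in>?S. signof p *
        (\<Sum>A\<in>Pow {1..n}. (\<Prod>j<n. if Suc (p j) \<in> A then ?d (p j) j else ?e (p j) j) * h (card A)))"
    by (simp only: sum_distrib_right sum_distrib_left) (subst sum.swap, simp only: mult.assoc)
  also have "\<dots> = (\<Sum>p\<in>?S. signof p *
        (\<Sum>J\<in>Pow {..<n}. (\<Prod>j<n. if j \<in> J then ?d (p j) j else ?e (p j) j) * h (card J)))"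
    by (rule sum.cong[OF refl]) (simp only: rows)
  also have "\<dots> = (\<Sum>J\<in>Pow {..<n}. Determinant.det (N J) * h (card J))"
  proof -
    have "Determinant.det (N J) =
        (\<Sum>p\<in>?S. signof p * (\<Prod>j<n. if j \<in> J then ?d (p j) j else ?e (p j) j))" for J
      unfolding N_def
      by (subst det_col[where n = n]) (auto intro!: sum.cong prod.cong dest: permutes_in_image)
    then show ?thesis
      by (simp only: sum_distrib_right sum_distrib_left) (subst sum.swap, simp only: mult.assoc)
  qed
  also have "\<dots> = (\<Sum>J\<in>{{}}. Determinant.det (N J) * h (card J))"
  proof (rule sum.mono_neutral_right)
    show "\<forall>J\<in>Pow {..<n} - {{}}. Determinant.det (N J) * h (card J) = 0"
      unfolding N_def using det_differentiated_columns_eq_0[of _ n "\<lambda>i. t (Suc i)"] by auto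
  qed auto
  also have "\<dots> = vandermonde n t * h 0"
    by (simp add: N_def partial_vandermonde_def flip: partial_vandermonde_empty)
  finally show ?thesis .
qed

section \<open>The fundamental theorem of calculus on a box\<close>

text \<open>
  \<open>B\<close> is the set of coordinates that take the lower end of their edge. The restriction to \<open>{1..n}\<close> makes
  the corner an element of the extensional box, and for \<open>n = 0\<close> the base point of \<open>box_integral\<close>.
\<close>

definition box_corner :: "nat \<Rightarrow> (nat \<Rightarrow> real) \<Rightarrow> nat set \<Rightarrow> nat \<Rightarrow> real" where
  "box_corner n x B = (\<lambda>i\<in>{1..n}. if i \<in> B then x i else x (i + 1))"

lemma box_corner_in_box:
  assumes "\<And>i. i \<in> {1..n} \<Longrightarrow> x i \<le> x (i + 1)"
  shows "box_corner n x B \<in> interlacing_box n x"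
  using assms by (auto simp: box_corner_def interlacing_box_def)

lemma sum_Pow_insert:
  assumes "finite S" "a \<notin> S"
  shows "(\<Sum>A\<in>Pow (insert a S). F A) = (\<Sum>A\<in>Pow S. F A + F (insert a A))"
proof -
  have "inj_on (insert a) (Pow S)"
    using assms(2) by (auto simp: inj_on_def)
  moreover have "Pow S \<inter> insert a ` Pow S = {}"
    using assms(2) by auto
  ultimately show ?thesis
    using assms(1)
    by (simp add: Pow_insert sum.union_disjoint sum.reindex sum.distrib)
qed

text \<open>
  \<open>\<Psi> m\<close> plays the role of \<open>\<partial>\<^sub>m\<^sub>+\<^sub>1 \<dots> \<partial>\<^sub>n H\<close> for \<open>H = \<Psi> n\<close>, so each member of the family is an antiderivative of the previous
  one in one variable. For a fixed value \<open>s\<close> of the outermost variable, the family \<open>\<Psi> 0, \<dots>, \<Psi> n\<close> satisfies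
  the hypotheses in the other variables, and the inner integral becomes a finite sum of values of \<open>\<Psi> n\<close>,
  each with antiderivative \<open>\<Psi> (n + 1)\<close> in \<open>s\<close>. Hence every integrand is a derivative, and its
  integrability needs no separate argument.
\<close>

lemma box_fundamental_theorem_of_calculus:
  assumes "\<And>i. i \<in> {1..n} \<Longrightarrow> x i \<le> x (i + 1)"
    and "\<And>m t. m \<in> {1..n} \<Longrightarrow> t \<in> interlacing_box n x \<Longrightarrow>
      ((\<lambda>s. \<Psi> m (t(m := s))) has_real_derivative \<Psi> (m - 1) t) (at (t m) within {x m..x (m + 1)})"
  shows "box_integral n x (\<Psi> 0) = (\<Sum>B\<in>Pow {1..n}. (-1) ^ card B * \<Psi> n (box_corner n x B))"
  using assms
proof (induction n arbitrary: \<Psi>)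
  case 0
  show ?case by (simp add: box_corner_def)
next
  case (Suc n)
  let ?I = "{x (Suc n)..x (Suc (Suc n))}"
  have box: "t(Suc n := s) \<in> interlacing_box (Suc n) x"
    if "t \<in> interlacing_box n x" "s \<in> ?I" for t s
    using that by (auto simp: interlacing_box_def PiE_iff extensional_def le_Suc_eq)
  have corner: "box_corner n x B \<in> interlacing_box n x" for B
    by (rule box_corner_in_box) (use Suc.prems(1) in auto)
  have inner: "box_integral n x (\<lambda>t. \<Psi> 0 (t(Suc n := s))) =
      (\<Sum>B\<in>Pow {1..n}. (-1) ^ card B * \<Psi> n ((box_corner n x B)(Suc n := s)))"
    if s: "s \<in> ?I" for s
  proof (rule Suc.IH)
    fix m t assume m: "m \<in> {1..n}" and t: "t \<in> interlacing_box n x"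
    show "((\<lambda>r. \<Psi> m ((t(m := r))(Suc n := s))) has_real_derivative \<Psi> (m - 1) (t(Suc n := s)))
        (at (t m) within {x m..x (m + 1)})"
    proof -
      have "(t(m := r))(Suc n := s) = (t(Suc n := s))(m := r)" for r
        using m by (auto intro: fun_upd_twist)
      then show ?thesis
        using Suc.prems(2)[OF _ box[OF t s], of m] m by (simp del: fun_upd_apply) (simp add: fun_upd_other)
    qed
  qed (use Suc.prems(1) in auto)
  have "((\<lambda>s. \<Psi> n ((box_corner n x B)(Suc n := s))) has_integral
      \<Psi> (Suc n) ((box_corner n x B)(Suc n := x (Suc (Suc n)))) -
      \<Psi> (Suc n) ((box_corner n x B)(Suc n := x (Suc n)))) ?I" for B
  proof (rule fundamental_theorem_of_calculus)
    show "x (Suc n) \<le> x (Suc (Suc n))" using Suc.prems(1)[of "Suc n"] by simp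
    show "((\<lambda>s. \<Psi> (Suc n) ((box_corner n x B)(Suc n := s))) has_vector_derivative
        \<Psi> n ((box_corner n x B)(Suc n := s))) (at s within ?I)" if s: "s \<in> ?I" for s
      using Suc.prems(2)[OF _ box[OF corner s], of "Suc n" B]
      by (simp add: has_real_derivative_iff_has_vector_derivative del: fun_upd_apply) simp
  qed
  then have "((\<lambda>s. \<Sum>B\<in>Pow {1..n}. (-1) ^ card B * \<Psi> n ((box_corner n x B)(Suc n := s)))
      has_integral (\<Sum>B\<in>Pow {1..n}. (-1) ^ card B *
        (\<Psi> (Suc n) ((box_corner n x B)(Suc n := x (Suc (Suc n)))) -
         \<Psi> (Suc n) ((box_corner n x B)(Suc n := x (Suc n)))))) ?I"
    by (intro has_integral_sum has_integral_mult_right) auto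
  then have "integral ?I (\<lambda>s. box_integral n x (\<lambda>t. \<Psi> 0 (t(Suc n := s)))) = (\<Sum>B\<in>Pow {1..n}. (-1) ^ card B *
        (\<Psi> (Suc n) ((box_corner n x B)(Suc n := x (Suc (Suc n)))) -
         \<Psi> (Suc n) ((box_corner n x B)(Suc n := x (Suc n)))))"
    by (subst integral_cong[OF inner]) auto
  then have "box_integral (Suc n) x (\<Psi> 0) = (\<Sum>B\<in>Pow {1..n}. (-1) ^ card B *
        (\<Psi> (Suc n) ((box_corner n x B)(Suc n := x (Suc (Suc n)))) -
         \<Psi> (Suc n) ((box_corner n x B)(Suc n := x (Suc n)))))"
    by simp
  also have "\<dots> = (\<Sum>B\<in>Pow {1..n}. (-1) ^ card B * \<Psi> (Suc n) (box_corner (Suc n) x B) +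
      (-1) ^ card (insert (Suc n) B) * \<Psi> (Suc n) (box_corner (Suc n) x (insert (Suc n) B)))"
  proof (rule sum.cong[OF refl])
    fix B assume B: "B \<in> Pow {1..n}"
    then have nB: "Suc n \<notin> B" by auto
    have finB: "finite B" using B finite_subset by auto
    have "box_corner (Suc n) x B = (box_corner n x B)(Suc n := x (Suc (Suc n)))"
      using nB by (auto simp: box_corner_def fun_eq_iff)
    moreover have "box_corner (Suc n) x (insert (Suc n) B) = (box_corner n x B)(Suc n := x (Suc n))"
      by (auto simp: box_corner_def fun_eq_iff)
    moreover have "card (insert (Suc n) B) = Suc (card B)"
      using nB finB by simp
    ultimately show "(-1) ^ card B *
        (\<Psi> (Suc n) ((box_corner n x B)(Suc n := x (Suc (Suc n)))) -
         \<Psi> (Suc n) ((box_corner n x B)(Suc n := x (Suc n)))) =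
        (-1) ^ card B * \<Psi> (Suc n) (box_corner (Suc n) x B) +
        (-1) ^ card (insert (Suc n) B) * \<Psi> (Suc n) (box_corner (Suc n) x (insert (Suc n) B))"
      by (simp add: algebra_simps)
  qed
  also have "\<dots> = (\<Sum>B\<in>Pow (insert (Suc n) {1..n}). (-1) ^ card B * \<Psi> (Suc n) (box_corner (Suc n) x B))"
    by (rule sum_Pow_insert[symmetric]) auto
  also have "insert (Suc n) {1..n} = {1..Suc n}"
    by auto
  finally show ?case .
qed

lemma down_closed_eq_initial_segment:
  assumes "B \<subseteq> {1..n}" and "\<And>i. 1 \<le> i \<Longrightarrow> Suc i \<in> B \<Longrightarrow> i \<in> B"
  shows "B = {1..card B}"
proof -
  have fin: "finite B" using assms(1) finite_subset by auto
  have down: "j \<in> B \<Longrightarrow> 1 \<le> i \<Longrightarrow> i \<le> j \<Longrightarrow> i \<in> B" for i j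
  proof (induction "j - i" arbitrary: i)
    case (Suc d)
    then have "Suc i \<in> B" by simp
    then show ?case using Suc.prems assms(2) by blast
  qed auto
  show ?thesis
  proof (cases "B = {}")
    case False
    have "B = {1..Max B}"
      using down[OF Max_in[OF fin False]] Max_ge[OF fin] assms(1) by force
    then show ?thesis by (metis card_atLeastAtMost diff_Suc_1)
  qed simp
qed

text \<open>
  Coordinates \<open>i\<close> and \<open>i + 1\<close> of a corner agree, both being \<open>x (i + 1)\<close>, when \<open>i\<close> takes its upper and \<open>i + 1\<close> its
  lower end. A corner avoids this for every \<open>i\<close> only if the set of its lower ends is an initial segment.
\<close>

lemma alternating_corner_sum:
  fixes H :: "(nat \<Rightarrow> real) \<Rightarrow> real"
  assumes H: "\<And>t i. 1 \<le> i \<Longrightarrow> Suc i \<le> n \<Longrightarrow> t i = t (Suc i) \<Longrightarrow> H t = 0"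
  shows "(\<Sum>B\<in>Pow {1..n}. (-1) ^ card B * H (box_corner n x B)) =
    (\<Sum>k\<le>n. (-1) ^ k * H (box_corner n x {1..k}))"
proof -
  have "(\<Sum>B\<in>Pow {1..n}. (-1) ^ card B * H (box_corner n x B)) =
      (\<Sum>B\<in>(\<lambda>k. {1..k}) ` {..n}. (-1) ^ card B * H (box_corner n x B))"
  proof (rule sum.mono_neutral_right)
    show "\<forall>B\<in>Pow {1..n} - (\<lambda>k. {1..k}) ` {..n}. (-1) ^ card B * H (box_corner n x B) = 0"
    proof
      fix B assume B: "B \<in> Pow {1..n} - (\<lambda>k. {1..k}) ` {..n}"
      then have "card B \<le> n" using card_mono[of "{1..n}" B] by auto
      then have "B \<noteq> {1..card B}" using B by auto
      then obtain i where i: "1 \<le> i" "Suc i \<in> B" "i \<notin> B"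
        using down_closed_eq_initial_segment[of B n] B by auto
      then have "Suc i \<le> n" using B by auto
      then have "H (box_corner n x B) = 0"
        using i by (intro H[of i]) (auto simp: box_corner_def)
      then show "(-1) ^ card B * H (box_corner n x B) = 0" by simp
    qed
  qed auto
  also have "\<dots> = (\<Sum>k\<le>n. (-1) ^ k * H (box_corner n x {1..k}))"
    by (subst sum.reindex) (auto simp: inj_on_def)
  finally show ?thesis .
qed

section \<open>The integral as a divided difference\<close>

lemma nth_deriv_within_has_derivative:
  assumes "Cn_on n S f" "k < n" "u \<in> S"
  shows "(nth_deriv_within k S f has_real_derivative nth_deriv_within (Suc k) S f u) (at u within S)"
  using assms
  by (auto simp: Cn_on_def differentiable_on_def has_real_derivative_iff_has_vector_derivative
      vector_derivative_works)

text \<open>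
  The family of successive antiderivatives comes from the product rule for \<open>H t = V t * f (\<sigma> t)\<close>: \<open>\<Psi> m\<close> is
  \<open>H\<close> differentiated in the variables with index above \<open>m\<close>. At \<open>m = 0\<close> the cancellation \<open>e\<^sub>a(\<partial>) V = 0\<close>
  leaves the integrand; at \<open>m = n\<close> the factor \<open>V\<close> makes \<open>H\<close> vanish when neighbouring coordinates agree.
\<close>

lemma box_integral_vandermonde_deriv:
  fixes x :: "nat \<Rightarrow> real"
  assumes x: "\<And>i. i \<in> {1..n} \<Longrightarrow> x i \<le> x (i + 1)"
    and S: "\<And>t. t \<in> interlacing_box n x \<Longrightarrow> (\<Sum>i = 1..n. t i) \<in> S"
    and f: "Cn_on n S f"
  shows "box_integral n x (\<lambda>t. vandermonde n t * nth_deriv_within n S f (\<Sum>i = 1..n. t i)) =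
    (\<Sum>k\<le>n. (-1) ^ k * (vandermonde n (box_corner n x {1..k}) * f (\<Sum>i = 1..n. box_corner n x {1..k} i)))"
proof -
  define g where "g k = nth_deriv_within k S f" for k
  define \<Psi> where "\<Psi> m t =
    (\<Sum>A\<in>Pow {m<..n}. partial_vandermonde n A t * g (n - m - card A) (\<Sum>i = 1..n. t i))" for m t
  have \<Psi>_0: "\<Psi> 0 = (\<lambda>t. vandermonde n t * g n (\<Sum>i = 1..n. t i))"
    using sum_partial_vandermonde[of n _ "\<lambda>a. g (n - a) _"]
    by (simp add: \<Psi>_def atLeastSucAtMost_greaterThanAtMost fun_eq_iff)
  have \<Psi>_n: "\<Psi> n t = vandermonde n t * f (\<Sum>i = 1..n. t i)" for t
    by (simp add: \<Psi>_def g_def partial_vandermonde_empty)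
  have \<Psi>_deriv: "((\<lambda>s. \<Psi> m (t(m := s))) has_real_derivative \<Psi> (m - 1) t)
      (at (t m) within {x m..x (m + 1)})"
    if m: "m \<in> {1..n}" and t: "t \<in> interlacing_box n x" for m t
  proof -
    let ?X = "{x m..x (m + 1)}" and ?\<sigma> = "\<lambda>t::nat \<Rightarrow> real. \<Sum>i = 1..n. t i"
    have line: "?\<sigma> (t(m := s)) = ?\<sigma> t - t m + s" for s
    proof -
      have "?\<sigma> (t(m := s)) = s + (\<Sum>i\<in>{1..n} - {m}. t i)"
        using m by (subst sum.remove[of _ m]) auto
      moreover have "?\<sigma> t = t m + (\<Sum>i\<in>{1..n} - {m}. t i)"
        using m by (subst sum.remove[of _ m]) auto
      ultimately show ?thesis by simp
    qed
    have "t(m := s) \<in> interlacing_box n x" if "s \<in> ?X" for s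
      using t m that by (auto simp: interlacing_box_def PiE_iff extensional_def)
    then have img: "(\<lambda>s. ?\<sigma> t - t m + s) ` ?X \<subseteq> S"
      using S unfolding line[symmetric] by blast
    have g_deriv: "((\<lambda>s. g k (?\<sigma> (t(m := s)))) has_real_derivative g (Suc k) (?\<sigma> t)) (at (t m) within ?X)"
      if k: "k < n" for k
    proof -
      have "(g k has_real_derivative g (Suc k) (?\<sigma> t)) (at (?\<sigma> t) within S)"
        unfolding g_def by (rule nth_deriv_within_has_derivative[OF f k S[OF t]])
      then have "(g k has_real_derivative g (Suc k) (?\<sigma> t))
          (at (?\<sigma> t - t m + t m) within (\<lambda>s. ?\<sigma> t - t m + s) ` ?X)"
        using img by (auto intro: has_field_derivative_subset)
      moreover have "((\<lambda>s. ?\<sigma> t - t m + s) has_real_derivative 1) (at (t m) within ?X)"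
        by (auto intro!: derivative_eq_intros)
      ultimately have "(g k \<circ> (\<lambda>s. ?\<sigma> t - t m + s) has_real_derivative g (Suc k) (?\<sigma> t) * 1)
          (at (t m) within ?X)"
        by (rule DERIV_image_chain)
      then show ?thesis unfolding line by (simp add: o_def)
    qed
    \<comment> \<open>Each term splits in two: \<open>t m\<close> hits the argument of \<open>g\<close>, or it joins the set \<open>A\<close>.\<close>
    have "((\<lambda>s. \<Psi> m (t(m := s))) has_real_derivative
        (\<Sum>A\<in>Pow {m<..n}.
          partial_vandermonde n A t * g (Suc (n - m - card A)) (?\<sigma> t) +
          partial_vandermonde n (insert m A) t * g (n - m - card A) (?\<sigma> t)))
        (at (t m) within ?X)"
      unfolding \<Psi>_def
    proof (rule DERIV_sum)
      fix A assume "A \<in> Pow {m<..n}"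
      then have A: "m \<notin> A" by auto
      have k: "n - m - card A < n" using m by auto
      show "((\<lambda>s. partial_vandermonde n A (t(m := s)) * g (n - m - card A) (?\<sigma> (t(m := s))))
          has_real_derivative
          partial_vandermonde n A t * g (Suc (n - m - card A)) (?\<sigma> t) +
          partial_vandermonde n (insert m A) t * g (n - m - card A) (?\<sigma> t)) (at (t m) within ?X)"
        using DERIV_mult'[OF partial_vandermonde_has_derivative[OF m A, of t ?X] g_deriv[OF k]] by simp
    qed
    also have "(\<Sum>A\<in>Pow {m<..n}.
          partial_vandermonde n A t * g (Suc (n - m - card A)) (?\<sigma> t) +
          partial_vandermonde n (insert m A) t * g (n - m - card A) (?\<sigma> t)) =
        (\<Sum>A\<in>Pow (insert m {m<..n}).
          partial_vandermonde n A t * g (n - (m - 1) - card A) (?\<sigma> t))"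
    proof (subst sum_Pow_insert, goal_cases)
      case 3
      show ?case
      proof (rule sum.cong[OF refl])
        fix A assume A: "A \<in> Pow {m<..n}"
        then have "finite A" "m \<notin> A" using finite_subset by auto
        moreover have "card A \<le> n - m"
          using A card_mono[of "{m<..n}" A] by auto
        ultimately show "partial_vandermonde n A t * g (Suc (n - m - card A)) (?\<sigma> t) +
          partial_vandermonde n (insert m A) t * g (n - m - card A) (?\<sigma> t) =
          partial_vandermonde n A t * g (n - (m - 1) - card A) (?\<sigma> t) +
          partial_vandermonde n (insert m A) t * g (n - (m - 1) - card (insert m A)) (?\<sigma> t)"
          using m by (simp add: Suc_diff_le)
      qed
    qed auto
    also have "insert m {m<..n} = {m - 1<..n}"
      using m by auto
    finally show ?thesis unfolding \<Psi>_def .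
  qed
  have "box_integral n x (\<Psi> 0) = (\<Sum>B\<in>Pow {1..n}. (-1) ^ card B * \<Psi> n (box_corner n x B))"
    by (rule box_fundamental_theorem_of_calculus[OF x \<Psi>_deriv])
  also have "\<dots> = (\<Sum>k\<le>n. (-1) ^ k * \<Psi> n (box_corner n x {1..k}))"
    by (rule alternating_corner_sum) (auto simp: \<Psi>_n intro: vandermonde_eq_0)
  finally show ?thesis
    by (simp add: \<Psi>_0 \<Psi>_n flip: g_def)
qed

theorem theorem1:
  fixes n :: nat and x y :: "nat \<Rightarrow> real"
  assumes "n \<ge> 1"
    and "strict_mono_on {1..n + 1} x"
    and "\<And>i. i \<in> {1..n + 1} \<Longrightarrow> y i = (\<Sum>j = 1..n + 1. x j) - x (n + 2 - i)"
  shows "strict_mono_on {1..n + 1} y \<and>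
    (\<forall>t \<in> interlacing_box n x. y 1 \<le> (\<Sum>i = 1..n. t i) \<and> (\<Sum>i = 1..n. t i) \<le> y (n + 1)) \<and>
    (\<forall>f. Cn_on n {y 1..y (n + 1)} f \<longrightarrow>
      box_integral n x
        (\<lambda>t. vandermonde n t * nth_deriv_within n {y 1..y (n + 1)} f (\<Sum>i = 1..n. t i))
      = vandermonde (n + 1) x * divided_difference (n + 1) y f)"
proof (intro conjI ballI allI impI)
  let ?S = "\<Sum>j = 1..n + 1. x j"
  have x_less: "x i < x j" if "1 \<le> i" "i < j" "j \<le> n + 1" for i j
    using strict_mono_onD[OF assms(2), of i j] that by auto
  show "strict_mono_on {1..n + 1} y"
    by (auto simp: strict_mono_on_def assms(3) intro!: x_less)
  have y_first: "y 1 = (\<Sum>i = 1..n. x i)"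
    by (simp add: assms(3))
  have y_last: "y (n + 1) = (\<Sum>i = 1..n. x (i + 1))"
    using sum.atLeast_Suc_atMost[of 1 "n + 1" x]
    by (simp add: assms(3) sum.shift_bounds_cl_Suc_ivl del: sum.cl_ivl_Suc)
  show lower: "y 1 \<le> (\<Sum>i = 1..n. t i)" if "t \<in> interlacing_box n x" for t
    unfolding y_first using that by (intro sum_mono) (auto simp: interlacing_box_def PiE_iff)
  show upper: "(\<Sum>i = 1..n. t i) \<le> y (n + 1)" if "t \<in> interlacing_box n x" for t
    unfolding y_last using that by (intro sum_mono) (auto simp: interlacing_box_def PiE_iff)
  fix f assume f: "Cn_on n {y 1..y (n + 1)} f"
  have inj: "inj_on x {1..Suc n}"
    using strict_mono_on_imp_inj_on[OF assms(2)] by simp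
  let ?W = "\<lambda>k. vandermonde n (\<lambda>i. if i < k then x i else x (Suc i))"
  let ?D = "\<lambda>k. \<Prod>j\<in>{1..n + 1} - {k}. x j - x k"
  have corner: "box_corner n x {1..k} i = (if i < Suc k then x i else x (Suc i))"
    if "i \<in> {1..n}" for i k
    using that by (simp add: box_corner_def)
  have corner_sum: "(\<Sum>i = 1..n. box_corner n x {1..k} i) = ?S - x (Suc k)" if k: "k \<le> n" for k
  proof -
    have "bij_betw (\<lambda>i. if i < Suc k then i else Suc i) {1..n} ({1..n + 1} - {Suc k})"
      by (rule bij_betw_byWitness[where f' = "\<lambda>i. if i < Suc k then i else i - 1"]) (use k in auto)
    from sum.reindex_bij_betw[OF this, of x]
    have "(\<Sum>i = 1..n. x (if i < Suc k then i else Suc i)) = sum x ({1..n + 1} - {Suc k})" .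
    moreover have "(\<Sum>i = 1..n. box_corner n x {1..k} i) =
        (\<Sum>i = 1..n. x (if i < Suc k then i else Suc i))"
      by (rule sum.cong) (auto simp: box_corner_def)
    ultimately have "(\<Sum>i = 1..n. box_corner n x {1..k} i) = sum x ({1..n + 1} - {Suc k})"
      by simp
    also have "\<dots> = ?S - x (Suc k)"
      by (subst sum_diff1) (use k in auto)
    finally show ?thesis .
  qed
  \<comment> \<open>The nodes number the entries of \<open>x\<close> backwards; \<open>k = n + 2 - i\<close> is the entry that \<open>y i\<close> omits.\<close>
  have dd: "divided_difference (n + 1) y f = (\<Sum>k = 1..n + 1. f (?S - x k) / ?D k)"
  proof -
    have rev: "bij_betw (\<lambda>i. n + 2 - i) {1..n + 1} {1..n + 1}"
      by (rule bij_betw_byWitness[where f' = "\<lambda>i. n + 2 - i"]) auto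
    have "divided_difference (n + 1) y f = (\<Sum>i = 1..n + 1. f (?S - x (n + 2 - i)) / ?D (n + 2 - i))"
      unfolding divided_difference_def
    proof (rule sum.cong[OF refl])
      fix i assume i: "i \<in> {1..n + 1}"
      have "bij_betw (\<lambda>j. n + 2 - j) ({1..n + 1} - {i}) ({1..n + 1} - {n + 2 - i})"
        by (rule bij_betw_byWitness[where f' = "\<lambda>i. n + 2 - i"]) (use i in auto)
      from prod.reindex_bij_betw[OF this, of "\<lambda>j. x j - x (n + 2 - i)"]
      moreover have "y i - y j = x (n + 2 - j) - x (n + 2 - i)" if "j \<in> {1..n + 1} - {i}" for j
        using i that by (simp add: assms(3))
      ultimately have "(\<Prod>j\<in>{1..n + 1} - {i}. y i - y j) = ?D (n + 2 - i)"
        by simp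
      then show "f (y i) / (\<Prod>j\<in>{1..n + 1} - {i}. y i - y j) =
          f (?S - x (n + 2 - i)) / ?D (n + 2 - i)"
        using i by (simp add: assms(3))
    qed
    also have "\<dots> = (\<Sum>k = 1..n + 1. f (?S - x k) / ?D k)"
      by (rule sum.reindex_bij_betw[OF rev])
    finally show ?thesis .
  qed
  have "box_integral n x
        (\<lambda>t. vandermonde n t * nth_deriv_within n {y 1..y (n + 1)} f (\<Sum>i = 1..n. t i)) =
      (\<Sum>k\<le>n. (-1) ^ k *
        (vandermonde n (box_corner n x {1..k}) * f (\<Sum>i = 1..n. box_corner n x {1..k} i)))"
  proof (rule box_integral_vandermonde_deriv[OF _ _ f])
    show "x i \<le> x (i + 1)" if "i \<in> {1..n}" for i
      using x_less[of i "i + 1"] that by simp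
  qed (use lower upper in auto)
  also have "\<dots> = (\<Sum>k\<le>n. (-1) ^ k * ?W (Suc k) * f (?S - x (Suc k)))"
  proof (rule sum.cong[OF refl])
    fix k assume "k \<in> {..n}"
    moreover have "vandermonde n (box_corner n x {1..k}) = ?W (Suc k)"
      by (rule vandermonde_cong) (rule corner)
    ultimately show "(-1) ^ k *
        (vandermonde n (box_corner n x {1..k}) * f (\<Sum>i = 1..n. box_corner n x {1..k} i)) =
        (-1) ^ k * ?W (Suc k) * f (?S - x (Suc k))"
      using corner_sum[of k] by simp
  qed
  also have "\<dots> = (\<Sum>k = 1..n + 1. (-1) ^ (k - 1) * ?W k * f (?S - x k))"
    using sum.shift_bounds_cl_Suc_ivl[of "\<lambda>k. (-1) ^ (k - 1) * ?W k * f (?S - x k)" 0 n]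
    by (simp add: atMost_atLeast0 del: sum.cl_ivl_Suc)
  also have "\<dots> = (\<Sum>k = 1..n + 1. vandermonde (n + 1) x * (f (?S - x k) / ?D k))"
  proof (rule sum.cong[OF refl])
    fix k assume "k \<in> {1..n + 1}"
    then have "(-1) ^ (k - 1) * ?W k = vandermonde (n + 1) x / ?D k"
      using vandermonde_div_prod_diff[of k n x] inj by simp
    then show "(-1) ^ (k - 1) * ?W k * f (?S - x k) = vandermonde (n + 1) x * (f (?S - x k) / ?D k)"
      by (simp only: times_divide_eq_left times_divide_eq_right)
  qed
  also have "\<dots> = vandermonde (n + 1) x * divided_difference (n + 1) y f"
    unfolding dd by (rule sum_distrib_left[symmetric])
  finally show "box_integral n x
        (\<lambda>t. vandermonde n t * nth_deriv_within n {y 1..y (n + 1)} f (\<Sum>i = 1..n. t i)) =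
      vandermonde (n + 1) x * divided_difference (n + 1) y f" .
qed

end
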